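(* For every $k\in\mathbb{N}$ ($k\ge 1$) and every complex $s$ with $\mathrm{Re}(s)>0$, $$\left[1-(2k-1)^{s-1}\right](2^{s}-1)\,\zeta(s)=\sum_{n=2}^{\infty}\left[1-\frac{\sum_{j=1}^{2k-1}(2j-1)^n}{(2k-1)^{n+1}}\right]\frac{\Gamma(n+s)}{2^n\,n!\,\Gamma(s)}\,\zeta(n+s).$$
   Context: $\zeta$ is the Riemann zeta function and $\Gamma$ the Gamma function. At $s=1$ the left-hand side is understood by analytic continuation (the factor $1-(2k-1)^{s-1}$ cancels the pole of $\zeta$). *)

theory Defs
  imports "HOL-Complex_Analysis.Complex_Analysis"
begin

(* The predicate determines f on -{1}, by the identity theorem on this connected set.
   The value at the pole 1 is left unspecified. *)
definition zeta :: "complex \<Rightarrow> complex" where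
  "zeta = (SOME f. f holomorphic_on (- {1}) \<and>
     (\<forall>s. Re s > 1 \<longrightarrow> (\<lambda>n. 1 / of_nat (Suc n) powr s) sums f s))"

end

theory Submission
  imports Defs
begin

text \<open>
  Put \<open>q = 2 k - 1\<close>. For \<open>Re s > 1\<close> and real \<open>\<bar>a\<bar> < 1\<close>, expanding \<open>(m - a)\<^sup>-\<^sup>s\<close> by the binomial series
  in \<open>a / m\<close> and exchanging the order of summation gives
  \<open>\<Sum>m\<ge>1. (m - a)\<^sup>-\<^sup>s = \<Sum>n\<ge>0. (pochhammer s n / n!) a\<^sup>n \<zeta>(s + n)\<close>
  (lemma \<open>sum_shifted_dzeta\<close> for the exchange, \<open>shifted_dirichlet_sums\<close> for the result).
  For \<open>a = 1/2\<close> the left-hand side runs over the halves of the odd numbers and equals \<open>(2\<^sup>s - 1) \<zeta>(s)\<close>.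
  For the \<open>q\<close> values \<open>a = (2 j - 1) / (2 q)\<close> the left-hand sides together run over all odd numbers
  divided by \<open>2 q\<close>, because the \<open>j\<close>-th one picks out one residue class modulo \<open>q\<close> of their indices;
  they add up to \<open>q\<^sup>s (2\<^sup>s - 1) \<zeta>(s)\<close> (lemma \<open>sums_over_residues\<close>). Subtracting \<open>1/q\<close> times the second
  identity from the first one yields \<open>(1 - q\<^sup>s\<^sup>-\<^sup>1) (2\<^sup>s - 1) \<zeta>(s)\<close> on the left. On the right the terms with
  \<open>n = 0\<close> and \<open>n = 1\<close> cancel, since the shifts have the same mean \<open>1/2\<close>, and what remains is the claimed series.

  That series involves only \<open>\<zeta>\<close> at arguments of real part greater than 2 when \<open>Re s > 0\<close>, so it
  converges locally uniformly and is holomorphic there (lemma \<open>zeta_tail_converges\<close>). The identity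
  theorem on the connected set \<open>{s. Re s > 0} - {1}\<close> extends the equation from \<open>Re s > 1\<close>.

  Since \<open>\<zeta>\<close> is characterised by a choice operator, the existence of the analytic continuation has to be
  established. The same expansion does it: the difference of the binomial series for \<open>a = 1/2\<close> and
  \<open>a = -1/2\<close> telescopes in \<open>m\<close> and expresses \<open>(s - 1) \<zeta>(s)\<close> through \<open>2\<^sup>s\<^sup>-\<^sup>1\<close> and the values
  \<open>\<zeta>(s + 1), \<zeta>(s + 2), \<dots>\<close> (lemma \<open>dzeta_recursion\<close>), so a continuation to a half-plane produces one
  to the half-plane shifted by 1 to the left (lemmas \<open>continuation_step\<close>, \<open>entire_continuation\<close>).
\<close>

section \<open>Series of holomorphic functions and the binomial series\<close>

text \<open>The majorant may depend on the point and may fail for finitely many terms: in the continuation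
  below, the first terms of the series are values of a function about which no bound is known.\<close>

lemma holomorphic_suminf:
  fixes f :: "nat \<Rightarrow> complex \<Rightarrow> complex"
  assumes "open A" and hol: "\<And>n. f n holomorphic_on A"
    and bound: "\<And>x. x \<in> A \<Longrightarrow> \<exists>U M. open U \<and> x \<in> U \<and> summable M \<and>
                  (\<forall>\<^sub>F n in sequentially. \<forall>s\<in>A \<inter> U. norm (f n s) \<le> M n)"
  shows "(\<lambda>s. \<Sum>n. f n s) holomorphic_on A"
    and "\<And>s. s \<in> A \<Longrightarrow> summable (\<lambda>n. f n s)"
proof -
  show "(\<lambda>s. \<Sum>n. f n s) holomorphic_on A"
  proof (rule holomorphic_uniform_sequence[OF \<open>open A\<close>, where f = "\<lambda>N s. \<Sum>n<N. f n s"])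
    show "(\<lambda>s. \<Sum>n<N. f n s) holomorphic_on A" for N
      by (intro holomorphic_intros hol)
    fix x assume "x \<in> A"
    obtain U M where U: "open U" "x \<in> U" "summable M"
      "\<forall>\<^sub>F n in sequentially. \<forall>s\<in>A \<inter> U. norm (f n s) \<le> M n"
      using bound[OF \<open>x \<in> A\<close>] by blast
    have "open (A \<inter> U)" "x \<in> A \<inter> U"
      using U \<open>open A\<close> \<open>x \<in> A\<close> by auto
    then obtain d where d: "d > 0" "cball x d \<subseteq> A \<inter> U"
      using open_contains_cball by blast
    have "\<forall>\<^sub>F n in sequentially. \<forall>s\<in>cball x d. norm (f n s) \<le> M n"
      using U(4) by eventually_elim (use d in blast)
    then have "uniform_limit (cball x d) (\<lambda>N s. \<Sum>n<N. f n s) (\<lambda>s. \<Sum>n. f n s) sequentially"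
      using U(3) by (rule Weierstrass_m_test_ev)
    with d show "\<exists>d>0. cball x d \<subseteq> A \<and>
        uniform_limit (cball x d) (\<lambda>N s. \<Sum>n<N. f n s) (\<lambda>s. \<Sum>n. f n s) sequentially"
      by blast
  qed
  fix s assume "s \<in> A"
  then obtain U M where U: "s \<in> U" "summable M"
      "\<forall>\<^sub>F n in sequentially. \<forall>s\<in>A \<inter> U. norm (f n s) \<le> M n"
    using bound by blast
  have "\<forall>\<^sub>F n in sequentially. norm (f n s) \<le> M n"
    using U(3) by eventually_elim (use U \<open>s \<in> A\<close> in blast)
  then show "summable (\<lambda>n. f n s)"
    using U(2) by (rule summable_comparison_test_ev)
qed

lemma norm_pochhammer_le:
  fixes s :: complex
  assumes "norm s \<le> R"
  shows "norm (pochhammer s n) \<le> pochhammer R n"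
proof (induction n)
  case (Suc n)
  have "norm (s + of_nat n) \<le> R + of_nat n"
    using norm_triangle_ineq[of s "of_nat n"] assms by simp
  then show ?case
    using Suc by (auto simp: pochhammer_Suc norm_mult intro!: mult_mono pochhammer_nonneg 
          order_trans[OF norm_ge_zero])
qed simp

lemma negative_binomial_sums:
  fixes z :: complex
  assumes "norm z < 1"
  shows "(\<lambda>n. pochhammer s n / fact n * z ^ n) sums ((1 - z) powr (-s))"
proof -
  have "(\<lambda>n. (- s gchoose n) * (- z) ^ n) sums ((1 - z) powr (-s))"
    using gen_binomial_complex[of "-z" "-s"] assms by simp
  also have "(\<lambda>n. (- s gchoose n) * (- z) ^ n) = (\<lambda>n. pochhammer s n / fact n * z ^ n)"
    by (simp add: gbinomial_pochhammer power_minus[of z] fun_eq_iff flip: power_add)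
  finally show ?thesis .
qed

lemma summable_pochhammer:
  fixes x :: real
  assumes "\<bar>x\<bar> < 1"
  shows "summable (\<lambda>n. pochhammer R n / fact n * x ^ n)"
proof -
  have "summable (\<lambda>n. (- R gchoose n) * (- x) ^ n)"
    using gen_binomial_real[of "-x" "-R"] assms by (auto simp: sums_iff)
  also have "(\<lambda>n. (- R gchoose n) * (- x) ^ n) = (\<lambda>n. pochhammer R n / fact n * x ^ n)"
    by (simp add: gbinomial_pochhammer power_minus[of x] fun_eq_iff flip: power_add)
  finally show ?thesis .
qed

section \<open>The Dirichlet series of zeta and exchange of summation\<close>

definition dzeta :: "complex \<Rightarrow> complex" where
  "dzeta s = (\<Sum>m. of_nat (Suc m) powr (-s))"

lemma norm_Suc_powr: "norm (of_nat (Suc m) powr s :: complex) = real (Suc m) powr Re s"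
  by (subst norm_powr_real_powr) auto

lemma summable_Suc_powr: "a > 1 \<Longrightarrow> summable (\<lambda>m. real (Suc m) powr (-a))"
  using summable_real_powr_iff[of "-a"] summable_Suc_iff[of "\<lambda>m. real m powr (-a)"] by simp

lemma dzeta_sums:
  assumes "Re s > 1"
  shows "(\<lambda>m. of_nat (Suc m) powr (-s)) sums dzeta s"
  unfolding dzeta_def
  by (intro summable_sums summable_norm_cancel[where f = "\<lambda>m. of_nat (Suc m) powr (-s)"])
     (use summable_Suc_powr[OF assms] in \<open>simp only: norm_Suc_powr uminus_complex.simps\<close>)

lemma Suc_powr_mono: "a \<le> b \<Longrightarrow> real (Suc m) powr (-b) \<le> real (Suc m) powr (-a)"
  by (intro powr_mono) auto

lemma holomorphic_dzeta: "dzeta holomorphic_on {s. Re s > 1}"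
  unfolding dzeta_def
proof (rule holomorphic_suminf(1))
  show "open {s. Re s > 1}"
    by (simp add: open_halfspace_Re_gt)
  show "(\<lambda>s. of_nat (Suc m) powr (-s)) holomorphic_on {s. Re s > 1}" for m
    by (intro holomorphic_intros)
  fix x :: complex assume "x \<in> {s. Re s > 1}"
  then obtain a where a: "1 < a" "a < Re x"
    using dense by blast
  show "\<exists>U M. open U \<and> x \<in> U \<and> summable M \<and> (\<forall>\<^sub>F m in sequentially.
          \<forall>s\<in>{s. Re s > 1} \<inter> U. norm (of_nat (Suc m) powr (-s) :: complex) \<le> M m)"
  proof (intro exI[of _ "{s. Re s > a}"] exI[of _ "\<lambda>m. real (Suc m) powr (-a)"] conjI
      always_eventually allI ballI)
    show "norm (of_nat (Suc m) powr (-s) :: complex) \<le> real (Suc m) powr (-a)"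
      if "s \<in> {s. Re s > 1} \<inter> {s. Re s > a}" for s m
      using that by (simp only: norm_Suc_powr uminus_complex.simps) (intro Suc_powr_mono, auto)
  qed (use a in \<open>simp_all only: mem_Collect_eq open_halfspace_Re_gt summable_Suc_powr\<close>)
qed

lemma dzeta_bounded:
  obtains B where "\<And>s. Re s \<ge> 2 \<Longrightarrow> norm (dzeta s) \<le> B"
proof
  fix s :: complex assume s: "Re s \<ge> 2"
  show "norm (dzeta s) \<le> (\<Sum>m. real (Suc m) powr (-2))"
    unfolding dzeta_def
  proof (rule norm_suminf_le)
    show "norm (of_nat (Suc m) powr (-s) :: complex) \<le> real (Suc m) powr (-2)" for m
      using s by (simp only: norm_Suc_powr uminus_complex.simps) (intro Suc_powr_mono, auto)
  qed (rule summable_Suc_powr, simp)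
qed

text \<open>Both sides are iterated sums of the double family \<open>c n (m + 1)\<^sup>-\<^sup>(\<^sup>s\<^sup>+\<^sup>n\<^sup>)\<close>. It is absolutely summable, being
dominated by the product family \<open>norm (c n) * (m + 1) powr (- Re s)\<close>.\<close>

lemma sum_shifted_dzeta:
  fixes c :: "nat \<Rightarrow> complex"
  assumes s: "Re s > 1" and c: "summable (\<lambda>n. norm (c n))"
    and g: "\<And>m. (\<lambda>n. c n * of_nat (Suc m) powr (-(s + of_nat n))) sums g m"
  obtains S where "g sums S" "(\<lambda>n. c n * dzeta (s + of_nat n)) sums S"
proof -
  define f where "f = (\<lambda>(m, n). c n * of_nat (Suc m) powr (-(s + of_nat n)))"
  have pw: "norm (f (m, n)) \<le> real (Suc m) powr (- Re s) * norm (c n)" for m n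
  proof -
    have "norm (of_nat (Suc m) powr (-(s + of_nat n)) :: complex) \<le> real (Suc m) powr (- Re s)"
      by (simp only: norm_Suc_powr uminus_complex.simps) (intro Suc_powr_mono, auto)
    from mult_right_mono[OF this, of "norm (c n)"] show ?thesis
      by (simp add: f_def norm_mult mult.commute)
  qed
  have fsum: "f summable_on UNIV \<times> UNIV"
  proof (rule abs_summable_summable)
    have "(\<lambda>(m, n). real (Suc m) powr (- Re s) * norm (c n)) summable_on UNIV \<times> UNIV"
    proof (rule summable_on_SigmaI)
      show "((\<lambda>n. case (m, n) of (m, n) \<Rightarrow> real (Suc m) powr (- Re s) * norm (c n)) has_sum
              real (Suc m) powr (- Re s) * (\<Sum>n. norm (c n))) UNIV" for m
        using c by (auto intro!: has_sum_cmult_right sums_nonneg_imp_has_sum summable_sums)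
      show "(\<lambda>m. real (Suc m) powr (- Re s) * (\<Sum>n. norm (c n))) summable_on UNIV"
        by (intro summable_on_cmult_left summable_nonneg_imp_summable_on
            summable_Suc_powr s) auto
    qed auto
    then show "(\<lambda>p. norm (f p)) summable_on UNIV \<times> UNIV"
      by (rule summable_on_comparison_test) (use pw in auto)
  qed
  define S where "S = infsum f (UNIV \<times> UNIV)"
  have S: "(f has_sum S) (UNIV \<times> UNIV)"
    unfolding S_def using fsum by (rule has_sum_infsum)
  have row: "((\<lambda>n. f (m, n)) has_sum g m) UNIV" for m
  proof (rule norm_summable_imp_has_sum)
    show "summable (\<lambda>n. norm (f (m, n)))"
      by (rule summable_comparison_test'[OF summable_mult[OF c, of "real (Suc m) powr (- Re s)"],
            where N = 0]) (use pw in auto)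
  qed (use g in \<open>simp add: f_def\<close>)
  have col: "((\<lambda>m. f (m, n)) has_sum (c n * dzeta (s + of_nat n))) UNIV" for n
  proof (rule norm_summable_imp_has_sum)
    show "summable (\<lambda>m. norm (f (m, n)))"
      by (rule summable_comparison_test'[OF
            summable_mult2[OF summable_Suc_powr[OF s], of "norm (c n)"], where N = 0])
         (use pw in auto)
    show "(\<lambda>m. f (m, n)) sums (c n * dzeta (s + of_nat n))"
      unfolding f_def prod.case by (intro sums_mult dzeta_sums) (use s in auto)
  qed
  have "(g has_sum S) UNIV"
    by (rule has_sum_SigmaD[OF S row])
  moreover have "((\<lambda>n. c n * dzeta (s + of_nat n)) has_sum S) UNIV"
    by (rule has_sum_SigmaD[OF S[THEN has_sum_swap[THEN iffD1]]]) (use col in auto)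
  ultimately show ?thesis
    using that has_sum_imp_sums by blast
qed

text \<open>This is the negative binomial series in \<open>z = a / (m + 1)\<close>, multiplied by \<open>(m + 1)\<^sup>-\<^sup>s\<close>.\<close>

lemma shifted_powr_sums:
  fixes s :: complex and a :: real
  assumes "\<bar>a\<bar> < 1"
  shows "(\<lambda>n. pochhammer s n / fact n * of_real a ^ n * of_nat (Suc m) powr (-(s + of_nat n)))
           sums (of_real (real (Suc m) - a) powr (-s))"
proof -
  define M where "M = real (Suc m)"
  have M: "M \<ge> 1" "complex_of_real M \<noteq> 0"
    by (simp_all only: M_def of_real_eq_0_iff)
  have aM: "\<bar>a / M\<bar> < 1"
    using assms M by (simp add: field_simps)
  have "(\<lambda>n. of_real M powr (-s) * (pochhammer s n / fact n * of_real (a / M) ^ n)) sums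
          (of_real M powr (-s) * (1 - of_real (a / M)) powr (-s))"
    by (intro sums_mult negative_binomial_sums) (use aM in \<open>simp only: norm_of_real\<close>)
  also have "of_real M powr (-s) * (1 - of_real (a / M)) powr (-s)
           = (of_real M * (1 - of_real (a / M))) powr (-s)"
    by (rule powr_times_real_left[symmetric]) (use M in auto)
  also have "of_real M * (1 - of_real (a / M)) = complex_of_real (M - a)"
    using M by (simp add: field_simps)
  also have "(\<lambda>n. of_real M powr (-s) * (pochhammer s n / fact n * of_real (a / M) ^ n))
           = (\<lambda>n. pochhammer s n / fact n * of_real a ^ n * of_real M powr (-(s + of_nat n)))"
  proof
    fix n
    have "of_real M powr (-(s + of_nat n)) = of_real M powr (-s) / of_real M ^ n"
      using M by (simp add: powr_diff)
    then show "of_real M powr (-s) * (pochhammer s n / fact n * of_real (a / M) ^ n)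
       = pochhammer s n / fact n * of_real a ^ n * of_real M powr (-(s + of_nat n))"
      by (simp add: power_divide)
  qed
  finally show ?thesis
    by (simp add: M_def)
qed

section \<open>Analytic continuation of zeta\<close>

text \<open>The coefficients of the difference of the binomial series at \<open>a = 1/2\<close> and \<open>a = -1/2\<close>. The
  constant terms of the two series cancel, so the index is shifted by one.\<close>

definition tcoeff :: "nat \<Rightarrow> complex" where
  "tcoeff n = ((1/2) ^ Suc n - (-1/2) ^ Suc n) / fact (Suc n)"

lemma norm_tcoeff_le: "norm (tcoeff n) \<le> 2 * (1/2) ^ Suc n / fact (Suc n)"
proof -
  have "norm ((1/2) ^ Suc n - (-1/2) ^ Suc n :: complex) \<le> 2 * (1/2) ^ Suc n"
    by (rule order_trans[OF norm_triangle_ineq4]) (simp only: norm_power, simp)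
  then show ?thesis
    by (simp add: tcoeff_def norm_divide divide_right_mono del: power_Suc fact_Suc)
qed

text \<open>Applied with exponent \<open>s - 1\<close>, the two binomial expansions at \<open>a = 1/2\<close> and \<open>a = -1/2\<close> give
\<open>(m + 1/2)\<^sup>1\<^sup>-\<^sup>s - (m + 3/2)\<^sup>1\<^sup>-\<^sup>s\<close>, whose sum over \<open>m \<ge> 0\<close> telescopes to \<open>(1/2)\<^sup>1\<^sup>-\<^sup>s = 2\<^sup>s\<^sup>-\<^sup>1\<close>. The term with
\<open>n = 0\<close> is \<open>(s - 1) \<zeta>(s)\<close>; all others only involve \<open>\<zeta>\<close> further to the right.\<close>

lemma dzeta_recursion:
  assumes s: "Re s > 1"
  shows "(\<lambda>n. tcoeff n * pochhammer (s - 1) (Suc n) * dzeta (s + of_nat n)) sums (2 powr (s - 1))"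
proof -
  define g where "g m = complex_of_real (real (Suc m) - 1/2) powr (-(s - 1))
                      - complex_of_real (real (Suc m) - (-1/2)) powr (-(s - 1))" for m
  define u where "u m = complex_of_real (real m + 1/2) powr (-(s - 1))" for m
  have g: "(\<lambda>n. tcoeff n * pochhammer (s - 1) (Suc n) * of_nat (Suc m) powr (-(s + of_nat n)))
             sums g m" for m
  proof -
    define t where "t a n = pochhammer (s - 1) n / fact n * of_real a ^ n *
        of_nat (Suc m) powr (-(s - 1 + of_nat n))" for a :: real and n
    have "(\<lambda>n. t (1/2) n - t (-1/2) n) sums g m"
      unfolding t_def g_def by (intro sums_diff shifted_powr_sums) auto
    then have "(\<lambda>n. t (1/2) (Suc n) - t (-1/2) (Suc n)) sums g m"
      using sums_Suc_iff[of "\<lambda>n. t (1/2) n - t (-1/2) n" "g m"] by (simp add: t_def)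
    also have "(\<lambda>n. t (1/2) (Suc n) - t (-1/2) (Suc n)) =
        (\<lambda>n. tcoeff n * pochhammer (s - 1) (Suc n) * of_nat (Suc m) powr (-(s + of_nat n)))"
      by (simp add: t_def tcoeff_def fun_eq_iff diff_divide_distrib right_diff_distrib
          left_diff_distrib mult_ac del: power_Suc fact_Suc pochhammer_Suc)
    finally show ?thesis .
  qed
  have "summable (\<lambda>n. norm (tcoeff n * pochhammer (s - 1) (Suc n)))"
  proof (rule summable_comparison_test')
    have "summable (\<lambda>n. pochhammer (norm (s - 1)) n / fact n * (1/2) ^ n)"
      by (rule summable_pochhammer) auto
    then show "summable (\<lambda>n. 2 * (pochhammer (norm (s - 1)) (Suc n) / fact (Suc n) * (1/2) ^ Suc n))"
      by (subst (asm) summable_Suc_iff[symmetric]) (rule summable_mult)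
    fix n :: nat assume "n \<ge> 0"
    have "norm (tcoeff n) * norm (pochhammer (s - 1) (Suc n))
            \<le> (2 * (1/2) ^ Suc n / fact (Suc n)) * pochhammer (norm (s - 1)) (Suc n)"
      by (intro mult_mono norm_tcoeff_le norm_pochhammer_le) auto
    then show "norm (norm (tcoeff n * pochhammer (s - 1) (Suc n)))
        \<le> 2 * (pochhammer (norm (s - 1)) (Suc n) / fact (Suc n) * (1/2) ^ Suc n)"
      by (simp add: norm_mult mult_ac del: power_Suc fact_Suc pochhammer_Suc)
  qed
  from sum_shifted_dzeta[OF s this g] obtain S where S: "g sums S"
    "(\<lambda>n. tcoeff n * pochhammer (s - 1) (Suc n) * dzeta (s + of_nat n)) sums S"
    by blast
  have "(\<lambda>m. norm (u m)) \<longlonglongrightarrow> 0"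
  proof -
    have "(\<lambda>m. (real m + 1/2) powr (-(Re s - 1))) \<longlonglongrightarrow> 0"
      using s filterlim_tendsto_add_at_top[OF tendsto_const[of "1/2"] filterlim_real_sequentially]
      by (intro tendsto_neg_powr) (simp_all add: add.commute)
    also have "(\<lambda>m. (real m + 1/2) powr (-(Re s - 1))) = (\<lambda>m. norm (u m))"
      unfolding u_def by (subst norm_powr_real_powr) (auto simp: fun_eq_iff)
    finally show ?thesis .
  qed
  then have "u \<longlonglongrightarrow> 0"
    by (simp only: tendsto_norm_zero_iff)
  from telescope_sums'[OF this] have "(\<lambda>m. u m - u (Suc m)) sums u 0"
    by simp
  also have "(\<lambda>m. u m - u (Suc m)) = g"
    by (simp add: u_def g_def fun_eq_iff algebra_simps)
  also have "u 0 = 2 powr (s - 1)"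
  proof -
    have "2 powr (s - 1) * (1/2) powr (s - 1) = (2 * (1/2) :: complex) powr (s - 1)"
      by (rule powr_times_real_left[symmetric]) auto
    then have "inverse ((1/2) powr (s - 1)) = (2 powr (s - 1) :: complex)"
      by (intro inverse_unique) (simp add: mult.commute)
    then show ?thesis
      by (simp only: u_def powr_minus) simp
  qed
  finally have "g sums (2 powr (s - 1))" .
  with S show ?thesis
    using sums_unique2 by metis
qed

text \<open>The recursion is solved for \<open>(s - 1) \<zeta>(s)\<close> and its right-hand side taken as the continuation. Working
with \<open>h(s) = (s - 1) \<zeta>(s)\<close> avoids the pole: the last factor \<open>s - 1 + n\<close> of \<open>pochhammer (s - 1) (n + 1)\<close>
is exactly the one that turns \<open>\<zeta>(s + n)\<close> into \<open>h(s + n)\<close>. On a bounded set all but finitely many of the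
arguments \<open>s + n\<close> have real part at least 2, where \<open>\<zeta>\<close> is bounded.\<close>

lemma continuation_step:
  assumes hol: "h holomorphic_on {s. Re s > a}"
    and eq: "\<And>s. Re s > 1 \<Longrightarrow> h s = (s - 1) * dzeta s"
  shows "\<exists>g. g holomorphic_on {s. Re s > a - 1} \<and> (\<forall>s. Re s > 1 \<longrightarrow> g s = (s - 1) * dzeta s)"
proof -
  define f where "f m s = tcoeff (Suc m) * pochhammer (s - 1) (Suc m) * h (s + of_nat (Suc m))"
    for m s
  have f_eq: "f m s = tcoeff (Suc m) * pochhammer (s - 1) (Suc (Suc m)) * dzeta (s + of_nat (Suc m))"
    if "Re s + real (Suc m) > 1" for m s
    using that by (simp add: f_def eq pochhammer_Suc[of "s - 1" "Suc m"] algebra_simps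
        del: pochhammer_Suc)
  obtain B where B: "\<And>s. Re s \<ge> 2 \<Longrightarrow> norm (dzeta s) \<le> B"
    using dzeta_bounded by blast
  have hol_sum: "(\<lambda>s. \<Sum>m. f m s) holomorphic_on {s. Re s > a - 1}"
  proof (rule holomorphic_suminf(1))
    show "open {s. Re s > a - 1}"
      by (simp add: open_halfspace_Re_gt)
    show "f m holomorphic_on {s. Re s > a - 1}" for m
    proof -
      have "(h \<circ> (\<lambda>s. s + of_nat (Suc m))) holomorphic_on {s. Re s > a - 1}"
        by (intro holomorphic_on_compose_gen[OF _ hol] holomorphic_intros) auto
      then show ?thesis
        unfolding f_def o_def by (intro holomorphic_intros)
    qed
    fix x :: complex
    define R where "R = norm x + 1"
    define M where "M m = 2 * B * (pochhammer (R + 1) (m + 2) / fact (m + 2) * (1/2) ^ (m + 2))" for m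
    show "\<exists>U M. open U \<and> x \<in> U \<and> summable M \<and>
        (\<forall>\<^sub>F m in sequentially. \<forall>s\<in>{s. Re s > a - 1} \<inter> U. norm (f m s) \<le> M m)"
    proof (intro exI[of _ "ball 0 R"] exI[of _ M] conjI)
      have "summable (\<lambda>n. pochhammer (R + 1) n / fact n * (1/2) ^ n)"
        by (rule summable_pochhammer) auto
      then show "summable M"
        unfolding M_def by (intro summable_mult) (rule summable_ignore_initial_segment)
      show "\<forall>\<^sub>F m in sequentially. \<forall>s\<in>{s. Re s > a - 1} \<inter> ball 0 R. norm (f m s) \<le> M m"
        using eventually_ge_at_top[of "nat \<lceil>R\<rceil> + 1"]
      proof eventually_elim
        case (elim m)
        have m: "real m \<ge> R + 1"
          using elim by linarith
        show ?case
        proof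
          fix s assume "s \<in> {s. Re s > a - 1} \<inter> ball 0 R"
          then have s: "norm s \<le> R" by simp
          have Re: "Re s + real (Suc m) \<ge> 2"
            using abs_Re_le_cmod[of s] s m by simp
          have s1: "norm (s - 1) \<le> R + 1"
            using norm_triangle_ineq4[of s 1] s by simp
          have poch_nonneg: "pochhammer (R + 1) n \<ge> 0" for n
            by (intro pochhammer_nonneg) (use norm_ge_zero[of x] in \<open>unfold R_def, linarith\<close>)
          have "norm (f m s) = norm (tcoeff (Suc m)) * norm (pochhammer (s - 1) (Suc (Suc m))) 
              * norm (dzeta (s + of_nat (Suc m)))"
            using Re by (subst f_eq) (simp_all add: norm_mult)
          also have "\<dots> \<le> (2 * (1/2) ^ Suc (Suc m) / fact (Suc (Suc m))) 
              * pochhammer (R + 1) (Suc (Suc m)) * B"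
            by (intro mult_mono norm_tcoeff_le norm_pochhammer_le s1 B)
               (use Re in \<open>auto intro!: mult_nonneg_nonneg divide_nonneg_pos poch_nonneg
                 simp del: power_Suc fact_Suc pochhammer_Suc\<close>)
          also have "\<dots> = M m"
            by (simp add: M_def mult_ac del: power_Suc fact_Suc pochhammer_Suc)
          finally show "norm (f m s) \<le> M m" .
        qed
      qed
    qed (auto simp: R_def add_nonneg_pos)
  qed
  show ?thesis
  proof (intro exI[of _ "\<lambda>s. 2 powr (s - 1) - (\<Sum>m. f m s)"] conjI allI impI)
    show "(\<lambda>s. 2 powr (s - 1) - (\<Sum>m. f m s)) holomorphic_on {s. Re s > a - 1}"
      by (intro holomorphic_intros hol_sum)
    fix s :: complex assume s: "Re s > 1"
    have "(\<lambda>m. tcoeff (Suc m) * pochhammer (s - 1) (Suc (Suc m)) * dzeta (s + of_nat (Suc m)))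
        sums (2 powr (s - 1) - (s - 1) * dzeta s)"
      using dzeta_recursion[OF s] by (subst sums_Suc_iff) (simp add: tcoeff_def)
    then have "(\<lambda>m. f m s) sums (2 powr (s - 1) - (s - 1) * dzeta s)"
      by (rule sums_cong[THEN iffD2, rotated]) (use s in \<open>simp add: f_eq\<close>)
    then show "2 powr (s - 1) - (\<Sum>m. f m s) = (s - 1) * dzeta s"
      by (simp add: sums_iff)
  qed
qed

text \<open>The continuations to the half-planes \<open>Re s > 1 - N\<close> agree where they overlap, by the identity theorem,
and hence glue to an entire function.\<close>

lemma entire_continuation:
  "\<exists>h. h holomorphic_on UNIV \<and> (\<forall>s. Re s > 1 \<longrightarrow> h s = (s - 1) * dzeta s)"
proof -
  have "\<exists>h. h holomorphic_on {s. Re s > 1 - real N} \<and> (\<forall>s. Re s > 1 \<longrightarrow> h s = (s - 1) * dzeta s)" for N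
  proof (induction N)
    case 0
    have "(\<lambda>s. (s - 1) * dzeta s) holomorphic_on {s. Re s > 1}"
      by (intro holomorphic_intros holomorphic_dzeta)
    then show ?case by auto
  next
    case (Suc N)
    then obtain h where "h holomorphic_on {s. Re s > 1 - real N}"
      "\<And>s. Re s > 1 \<Longrightarrow> h s = (s - 1) * dzeta s" by blast
    from continuation_step[OF this] show ?case
      by (simp add: algebra_simps)
  qed
  then obtain H where H: "\<And>N. H N holomorphic_on {s. Re s > 1 - real N}"
      "\<And>N s. Re s > 1 \<Longrightarrow> H N s = (s - 1) * dzeta s"
    by metis
  have agree: "H N s = H N' s" if "N \<le> N'" "Re s > 1 - real N" for N N' s
  proof (rule analytic_continuation_open[of "{s. Re s > 1}" "{s. Re s > 1 - real N}"
        "H N" "H N'"])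
    show "{s. Re s > 1} \<noteq> {}"
      by (auto intro!: exI[of _ 2])
    show "H N' holomorphic_on {s. Re s > 1 - real N}"
      by (rule holomorphic_on_subset[OF H(1)]) (use that in auto)
  qed (use that H in \<open>auto simp: open_halfspace_Re_gt convex_halfspace_Re_gt convex_connected\<close>)
  define n where "n s = nat \<lceil>2 - Re s\<rceil>" for s
  have n: "Re s > 1 - real (n s)" for s
    unfolding n_def by linarith
  define h where "h s = H (n s) s" for s
  have h: "h s = H N s" if "Re s > 1 - real N" for N s
    using agree[of N "n s" s, symmetric] agree[of "n s" N s] n[of s] that
    unfolding h_def by (meson nle_le)
  have "h holomorphic_on (\<Union>N. {s. Re s > 1 - real N})"
  proof (rule holomorphic_on_UN_open)
    show "h holomorphic_on {s. Re s > 1 - real N}" for N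
      by (rule holomorphic_transform[OF H(1)]) (use h in auto)
  qed (simp add: open_halfspace_Re_gt)
  moreover have "(\<Union>N. {s. Re s > 1 - real N}) = UNIV"
    using n by blast
  moreover have "h s = (s - 1) * dzeta s" if "Re s > 1" for s
    by (simp add: h_def H(2) that)
  ultimately show ?thesis by auto
qed

lemma zeta_props:
  shows holomorphic_zeta: "zeta holomorphic_on (- {1})"
    and zeta_sums: "\<And>s. Re s > 1 \<Longrightarrow> (\<lambda>n. 1 / of_nat (Suc n) powr s) sums zeta s"
proof -
  obtain h where h: "h holomorphic_on UNIV" "\<And>s. Re s > 1 \<Longrightarrow> h s = (s - 1) * dzeta s"
    using entire_continuation by blast
  have "(\<lambda>s. h s / (s - 1)) holomorphic_on (- {1})"
    by (intro holomorphic_intros holomorphic_on_subset[OF h(1)]) auto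
  moreover have "(\<lambda>n. 1 / of_nat (Suc n) powr s) sums (h s / (s - 1))" if "Re s > 1" for s
  proof -
    have "s \<noteq> 1" using that by auto
    then show ?thesis
      using dzeta_sums[OF that] h(2)[OF that] by (simp add: powr_minus_divide)
  qed
  ultimately have "\<exists>f. f holomorphic_on (- {1}) \<and>
      (\<forall>s. Re s > 1 \<longrightarrow> (\<lambda>n. 1 / of_nat (Suc n) powr s) sums f s)"
    by blast
  from someI_ex[OF this] show "zeta holomorphic_on (- {1})"
    "\<And>s. Re s > 1 \<Longrightarrow> (\<lambda>n. 1 / of_nat (Suc n) powr s) sums zeta s"
    unfolding zeta_def by blast+
qed

lemma zeta_eq_dzeta: "Re s > 1 \<Longrightarrow> zeta s = dzeta s"
  by (rule sums_unique2[OF zeta_sums]) (use dzeta_sums[of s] in \<open>simp_all add: powr_minus_divide\<close>)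

section \<open>Shifted zeta sums\<close>

text \<open>The terms with \<open>n = m + 2\<close> of the expansion of \<open>\<Sum>m\<ge>1. (m - a)\<^sup>-\<^sup>s\<close>. From \<open>n = 2\<close> on,
  \<open>\<zeta>\<close> is evaluated only at real parts greater than 2 when \<open>Re s > 0\<close>, where it is bounded; the two
  omitted terms, of which \<open>n = 0\<close> has a pole at \<open>s = 1\<close>, cancel in the identity.\<close>

definition zeta_tail :: "real \<Rightarrow> nat \<Rightarrow> complex \<Rightarrow> complex" where
  "zeta_tail a m s =
     pochhammer s (m + 2) / fact (m + 2) * of_real a ^ (m + 2) * zeta (s + of_nat (m + 2))"

lemma zeta_tail_converges:
  assumes a: "\<bar>a\<bar> < 1"
  shows "(\<lambda>s. \<Sum>m. zeta_tail a m s) holomorphic_on {s. Re s > 0}"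
    and "\<And>s. Re s > 0 \<Longrightarrow> summable (\<lambda>m. zeta_tail a m s)"
proof -
  obtain B where B: "\<And>s. Re s \<ge> 2 \<Longrightarrow> norm (dzeta s) \<le> B"
    using dzeta_bounded by blast
  have op: "open {s. Re s > 0}"
    by (simp add: open_halfspace_Re_gt)
  have hol: "zeta_tail a m holomorphic_on {s. Re s > 0}" for m
  proof -
    have "(zeta \<circ> (\<lambda>s. s + of_nat (m + 2))) holomorphic_on {s. Re s > 0}"
      by (intro holomorphic_on_compose_gen[OF _ holomorphic_zeta] holomorphic_intros)
         (auto simp: complex_eq_iff)
    then show ?thesis
      unfolding zeta_tail_def[abs_def] o_def by (intro holomorphic_intros) auto
  qed
  have bound: "\<exists>U M. open U \<and> x \<in> U \<and> summable M \<and>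
      (\<forall>\<^sub>F m in sequentially. \<forall>s\<in>{s. Re s > 0} \<inter> U. norm (zeta_tail a m s) \<le> M m)" for x
  proof -
    define R where "R = norm x + 1"
    define M where "M m = pochhammer R (m + 2) / fact (m + 2) * \<bar>a\<bar> ^ (m + 2) * B" for m
    have poch_nonneg: "pochhammer R n \<ge> 0" for n
      by (intro pochhammer_nonneg) (use norm_ge_zero[of x] in \<open>unfold R_def, linarith\<close>)
    have "summable (\<lambda>n. pochhammer R n / fact n * \<bar>a\<bar> ^ n)"
      by (rule summable_pochhammer) (use a in auto)
    then have "summable M"
      unfolding M_def by (intro summable_mult2) (rule summable_ignore_initial_segment)
    moreover have "norm (zeta_tail a m s) \<le> M m" if "s \<in> {s. Re s > 0} \<inter> ball 0 R" for m s
    proof -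
      have s: "norm s \<le> R" "Re s > 0"
        using that by auto
      have "norm (zeta_tail a m s) = norm (pochhammer s (m + 2)) / fact (m + 2) * \<bar>a\<bar> ^ (m + 2)
          * norm (dzeta (s + of_nat (m + 2)))"
        unfolding zeta_tail_def using s
        by (subst zeta_eq_dzeta) (simp_all add: norm_mult norm_divide norm_power norm_fact
              del: fact_Suc power_Suc pochhammer_Suc)
      also have "\<dots> \<le> M m"
        unfolding M_def
        by (intro mult_mono divide_right_mono norm_pochhammer_le s B)
           (use s in \<open>auto intro!: mult_nonneg_nonneg divide_nonneg_pos poch_nonneg\<close>)
      finally show ?thesis .
    qed
    ultimately show ?thesis
      by (intro exI[of _ "ball 0 R"] exI[of _ M]) (auto simp: R_def add_nonneg_pos)
  qed
  show "(\<lambda>s. \<Sum>m. zeta_tail a m s) holomorphic_on {s. Re s > 0}"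
    by (rule holomorphic_suminf(1)[OF op hol bound])
  show "summable (\<lambda>m. zeta_tail a m s)" if "Re s > 0" for s
    by (rule holomorphic_suminf(2)[OF op hol bound]) (use that in auto)
qed

lemma shifted_dirichlet_sums:
  assumes a: "\<bar>a\<bar> < 1" and s: "Re s > 1"
  shows "(\<lambda>m. of_real (real (Suc m) - a) powr (-s)) sums
           ((\<Sum>m. zeta_tail a m s) + zeta s + s * of_real a * zeta (s + 1))"
proof -
  define t where "t n = pochhammer s n / fact n * of_real a ^ n * zeta (s + of_nat n)" for n
  have "summable (\<lambda>n. norm (pochhammer s n / fact n * of_real a ^ n))"
  proof (rule summable_comparison_test')
    show "summable (\<lambda>n. pochhammer (norm s) n / fact n * \<bar>a\<bar> ^ n)"
      by (rule summable_pochhammer) (use a in auto)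
    show "norm (norm (pochhammer s n / fact n * of_real a ^ n))
            \<le> pochhammer (norm s) n / fact n * \<bar>a\<bar> ^ n" for n
      by (auto simp: norm_mult norm_divide norm_power
          intro!: mult_right_mono divide_right_mono norm_pochhammer_le)
  qed
  from sum_shifted_dzeta[OF s this shifted_powr_sums[OF a]] obtain S where S:
    "(\<lambda>m. of_real (real (Suc m) - a) powr (-s)) sums S"
    "(\<lambda>n. pochhammer s n / fact n * of_real a ^ n * dzeta (s + of_nat n)) sums S"
    by blast
  have "t = (\<lambda>n. pochhammer s n / fact n * of_real a ^ n * dzeta (s + of_nat n))"
    using s by (simp add: t_def zeta_eq_dzeta fun_eq_iff)
  with S(2) have "t sums S"
    by (simp only:)
  then have "(\<lambda>n. t (n + 2)) sums (S - (\<Sum>i<2. t i))"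
    by (rule sums_split_initial_segment)
  then have "(\<Sum>m. zeta_tail a m s) = S - (zeta s + s * of_real a * zeta (s + 1))"
    by (simp add: sums_iff t_def zeta_tail_def numeral_2_eq_2)
  with S(1) show ?thesis
    by simp
qed

section \<open>Sums over odd numbers and their residue classes\<close>

lemma odd_dirichlet_sums:
  assumes s: "Re s > 1"
  shows "(\<lambda>n. of_nat (2 * n + 1) powr (-s)) sums ((1 - 2 powr (-s)) * zeta s)"
proof -
  have z: "(\<lambda>n. of_nat (Suc n) powr (-s)) sums zeta s"
    using zeta_sums[OF s] by (simp add: powr_minus_divide)
  have "(\<lambda>n. of_nat (2 * n + 1) powr (-s) + of_nat (2 * n + 2) powr (-s)) sums zeta s"
    using sums_group[OF z, of 2] by (simp add: mult.commute numeral_2_eq_2 add.commute)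
  moreover have "(\<lambda>n. of_nat (2 * n + 2) powr (-s)) sums (2 powr (-s) * zeta s)"
  proof -
    have "of_nat (2 * n + 2) powr (-s) = 2 powr (-s) * of_nat (Suc n) powr (-s)" for n
      using powr_times_real_left[of 2 "of_nat (Suc n)" "-s"] by (simp add: algebra_simps)
    then show ?thesis
      using sums_mult[OF z, of "2 powr (-s)"] by simp
  qed
  ultimately show ?thesis
    using sums_diff by (fastforce simp: algebra_simps)
qed

text \<open>Since \<open>m + 1 - (2 j - 1) / (2 q) = (2 (m q + q - j) + 1) / (2 q)\<close>, the inner sum is \<open>(2 q)\<^sup>s\<close> times a block
of \<open>q\<close> consecutive terms of the series over the odd numbers.\<close>

lemma sums_over_residues:
  fixes q :: nat
  assumes s: "Re s > 1" and q: "q > 0"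
  shows "(\<lambda>m. \<Sum>j=1..q. complex_of_real (real (Suc m) - (2 * real j - 1) / (2 * real q)) powr (-s))
           sums (of_nat q powr s * (2 powr s - 1) * zeta s)"
proof -
  define u where "u n = complex_of_nat (2 * n + 1) powr (-s)" for n
  have "(\<lambda>m. sum u {m * q..<m * q + q}) sums ((1 - 2 powr (-s)) * zeta s)"
    using odd_dirichlet_sums[OF s] q unfolding u_def by (intro sums_group)
  then have "(\<lambda>m. of_nat (2 * q) powr s * sum u {m * q..<m * q + q}) sums
        (of_nat (2 * q) powr s * ((1 - 2 powr (-s)) * zeta s))"
    by (rule sums_mult)
  also have "(\<lambda>m. of_nat (2 * q) powr s * sum u {m * q..<m * q + q}) =
      (\<lambda>m. \<Sum>j=1..q. complex_of_real (real (Suc m) - (2 * real j - 1) / (2 * real q)) powr (-s))"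
  proof
    fix m
    have "(\<Sum>j=1..q. complex_of_real (real (Suc m) - (2 * real j - 1) / (2 * real q)) powr (-s)) =
        (\<Sum>i\<in>{m * q..<m * q + q}. of_nat (2 * q) powr s * u i)"
    proof (rule sum.reindex_bij_witness[of _ "\<lambda>i. m * q + q - i" "\<lambda>j. m * q + q - j"])
      fix j assume j: "j \<in> {1..q}"
      define i where "i = m * q + q - j"
      have i: "real i = real m * real q + real q - real j"
        using j by (simp add: i_def of_nat_diff)
      have "of_nat (2 * q) powr s * u i =
          of_nat (2 * q) powr s * complex_of_nat (2 * i + 1) powr (-s)"
        by (simp add: u_def)
      also have "complex_of_nat (2 * i + 1) = of_nat (2 * q) *
          complex_of_real (real (Suc m) - (2 * real j - 1) / (2 * real q))"
      proof -
        have "real (2 * i + 1) = real (2 * q) * (real (Suc m) - (2 * real j - 1) / (2 * real q))"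
          using q by (simp add: i field_simps)
        then have "complex_of_real (real (2 * i + 1)) = complex_of_real
            (real (2 * q) * (real (Suc m) - (2 * real j - 1) / (2 * real q)))"
          by (rule arg_cong)
        then show ?thesis
          by (simp only: of_real_of_nat_eq of_real_mult)
      qed
      also have "\<dots> powr (-s) = of_nat (2 * q) powr (-s) *
          complex_of_real (real (Suc m) - (2 * real j - 1) / (2 * real q)) powr (-s)"
        by (rule powr_times_real_left) auto
      also have "of_nat (2 * q) powr s * \<dots> =
          complex_of_real (real (Suc m) - (2 * real j - 1) / (2 * real q)) powr (-s)"
        using q by (simp add: powr_minus field_simps)
      finally show "of_nat (2 * q) powr s * u (m * q + q - j) =
          complex_of_real (real (Suc m) - (2 * real j - 1) / (2 * real q)) powr (-s)"
        by (simp only: i_def)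
    qed auto
    then show "of_nat (2 * q) powr s * sum u {m * q..<m * q + q} =
        (\<Sum>j=1..q. complex_of_real (real (Suc m) - (2 * real j - 1) / (2 * real q)) powr (-s))"
      by (simp only: sum_distrib_left)
  qed
  also have "of_nat (2 * q) powr s * ((1 - 2 powr (-s)) * zeta s)
           = of_nat q powr s * (2 powr s - 1) * zeta s"
  proof -
    have "complex_of_nat (2 * q) powr s = 2 powr s * of_nat q powr s"
      using powr_times_real_left[of 2 "of_nat q" s] by simp
    then show ?thesis
      by (simp add: powr_minus field_simps)
  qed
  finally show ?thesis .
qed

text \<open>The subtracted multiple of \<open>\<zeta>(s)\<close> and \<open>\<zeta>(s + 1)\<close> collects the terms \<open>n = 0\<close> and \<open>n = 1\<close>. It is \<open>q\<close> times
an expression independent of \<open>q\<close>, because the shifts \<open>(2 j - 1) / (2 q)\<close> have mean \<open>1/2\<close>; after division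
by \<open>q\<close> it therefore cancels when the case \<open>q = 1\<close>, where the only shift is \<open>1/2\<close>, is compared with the general case.\<close>

lemma residue_tails_sum:
  fixes q :: nat
  assumes s: "Re s > 1" and q: "q > 0"
  shows "(\<Sum>j=1..q. (\<Sum>m. zeta_tail ((2 * real j - 1) / (2 * real q)) m s))
       = of_nat q powr s * (2 powr s - 1) * zeta s - of_nat q * (zeta s + s / 2 * zeta (s + 1))"
proof -
  define a where "a j = (2 * real j - 1) / (2 * real q)" for j
  have a: "\<bar>a j\<bar> < 1" if "j \<in> {1..q}" for j
    using that q by (auto simp: a_def field_simps)
  have "(\<Sum>j=1..q. a j) = real q / 2"
  proof -
    have "(\<Sum>j=1..n. 2 * real j - 1) = (real n)\<^sup>2" for n
      by (induction n) (auto simp: power2_eq_square algebra_simps)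
    then show ?thesis
      using q by (simp add: a_def power2_eq_square flip: sum_divide_distrib)
  qed
  from arg_cong[OF this, of complex_of_real]
  have a_sum: "(\<Sum>j=1..q. complex_of_real (a j)) = of_nat q / 2"
    by (simp only: of_real_sum) simp
  have "(\<lambda>m. \<Sum>j=1..q. complex_of_real (real (Suc m) - a j) powr (-s)) sums
      (\<Sum>j=1..q. (\<Sum>m. zeta_tail (a j) m s) + zeta s + s * of_real (a j) * zeta (s + 1))"
    by (intro sums_sum shifted_dirichlet_sums a s)
  then have "(\<Sum>j=1..q. (\<Sum>m. zeta_tail (a j) m s) + zeta s + s * of_real (a j) * zeta (s + 1))
      = of_nat q powr s * (2 powr s - 1) * zeta s"
    using sums_over_residues[OF s q] unfolding a_def by (rule sums_unique2)
  also have "(\<Sum>j=1..q. (\<Sum>m. zeta_tail (a j) m s) + zeta s + s * of_real (a j) * zeta (s + 1))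
      = (\<Sum>j=1..q. (\<Sum>m. zeta_tail (a j) m s)) + of_nat q * zeta s
          + s * (\<Sum>j=1..q. of_real (a j)) * zeta (s + 1)"
    by (simp add: sum.distrib sum_distrib_left sum_distrib_right)
  finally show ?thesis
    unfolding a_sum by (simp add: a_def algebra_simps)
qed

section \<open>The series identity\<close>

theorem mainTheorem5:
  fixes k :: nat
  assumes "k \<ge> 1"
  shows "\<exists>F :: complex \<Rightarrow> complex.
    F holomorphic_on {s. Re s > 0} \<and>
    (\<forall>s. Re s > 0 \<and> s \<noteq> 1 \<longrightarrow>
       F s = (1 - of_nat (2 * k - 1) powr (s - 1)) * (2 powr s - 1) * zeta s) \<and>
    (\<forall>s. Re s > 0 \<longrightarrow>
       (\<lambda>m. let n = m + 2 in
          (1 - (\<Sum>j=1..2*k-1. of_nat (2 * j - 1) ^ n) / of_nat (2 * k - 1) ^ (n + 1))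
          * (Gamma (of_nat n + s) / (2 ^ n * fact n * Gamma s)) * zeta (of_nat n + s)) sums F s)"
proof -
  define q where "q = 2 * k - 1"
  have q: "q > 0" using assms by (simp add: q_def)
  define a where "a j = (2 * real j - 1) / (2 * real q)" for j
  have a: "\<bar>a j\<bar> < 1" if "j \<in> {1..q}" for j
    using that q by (auto simp: a_def field_simps)
  define F where "F s = (\<Sum>m. zeta_tail (1/2) m s) - (\<Sum>j=1..q. \<Sum>m. zeta_tail (a j) m s) / of_nat q"
    for s
  define L where "L s = (1 - of_nat q powr (s - 1)) * (2 powr s - 1) * zeta s" for s
  have hol_F: "F holomorphic_on {s. Re s > 0}"
    unfolding F_def[abs_def] using q
    by (intro holomorphic_intros zeta_tail_converges(1) a) auto
  have F_eq: "F s = L s" if s: "Re s > 1" for s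
  proof -
    have "(\<Sum>m. zeta_tail (1/2) m s) = (2 powr s - 1) * zeta s - (zeta s + s / 2 * zeta (s + 1))"
      using residue_tails_sum[OF s, of 1] by simp
    moreover have "(\<Sum>j=1..q. \<Sum>m. zeta_tail (a j) m s) / of_nat q
       = of_nat q powr (s - 1) * (2 powr s - 1) * zeta s - (zeta s + s / 2 * zeta (s + 1))"
      unfolding a_def residue_tails_sum[OF s q] using q by (simp add: powr_diff diff_divide_distrib)
    ultimately have "F s = (2 powr s - 1) * zeta s - of_nat q powr (s - 1) * (2 powr s - 1) * zeta s"
      by (simp only: F_def) simp
    then show ?thesis
      by (simp add: L_def algebra_simps)
  qed
  have "F s = L s" if s: "Re s > 0" "s \<noteq> 1" for s
  proof (rule analytic_continuation_open[of "{s. Re s > 1}" "{s. Re s > 0} - {1}" F L])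
    show "open ({s. Re s > 0} - {1 :: complex})"
      by (intro open_delete) (simp add: open_halfspace_Re_gt)
    show "connected ({s. Re s > 0} - {1 :: complex})"
      by (intro connected_open_delete)
         (simp_all add: open_halfspace_Re_gt convex_halfspace_Re_gt convex_connected)
    show "{s :: complex. Re s > 1} \<noteq> {}"
      by (auto intro!: exI[of _ 2])
    show "L holomorphic_on {s. Re s > 0} - {1}"
      unfolding L_def[abs_def]
      by (intro holomorphic_intros holomorphic_on_subset[OF holomorphic_zeta]) auto
    show "F holomorphic_on {s. Re s > 0} - {1}"
      by (rule holomorphic_on_subset[OF hol_F]) auto
  qed (use s F_eq in \<open>auto simp: open_halfspace_Re_gt\<close>)
  moreover have "(\<lambda>m. let n = m + 2 in
          (1 - (\<Sum>j=1..q. of_nat (2 * j - 1) ^ n) / of_nat q ^ (n + 1))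
          * (Gamma (of_nat n + s) / (2 ^ n * fact n * Gamma s)) * zeta (of_nat n + s)) sums F s"
    if s: "Re s > 0" for s
  proof -
    have "(\<lambda>m. zeta_tail (1/2) m s - (\<Sum>j=1..q. zeta_tail (a j) m s) / of_nat q) sums F s"
      unfolding F_def
      by (intro sums_diff sums_divide sums_sum summable_sums zeta_tail_converges(2) a s) auto
    moreover have "zeta_tail (1/2) m s - (\<Sum>j=1..q. zeta_tail (a j) m s) / of_nat q =
        (let n = m + 2 in
          (1 - (\<Sum>j=1..q. of_nat (2 * j - 1) ^ n) / of_nat q ^ (n + 1))
          * (Gamma (of_nat n + s) / (2 ^ n * fact n * Gamma s)) * zeta (of_nat n + s))" for m
    proof -
      define n where "n = m + 2"
      define c where "c = pochhammer s n / fact n * zeta (s + of_nat n)"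
      have "s \<notin> \<int>\<^sub>\<le>\<^sub>0"
        using s by (auto elim!: nonpos_Ints_cases)
      then have G: "Gamma (of_nat n + s) / (2 ^ n * fact n * Gamma s) * zeta (of_nat n + s) = c / 2 ^ n"
        by (simp add: c_def pochhammer_Gamma add.commute)
      have "complex_of_real (a j) ^ n = of_nat (2 * j - 1) ^ n / (2 ^ n * of_nat q ^ n)"
        if "j \<in> {1..q}" for j
        using that by (simp add: a_def of_nat_diff power_divide power_mult_distrib)
      then have "(\<Sum>j=1..q. complex_of_real (a j) ^ n)
          = (\<Sum>j=1..q. of_nat (2 * j - 1) ^ n) / (2 ^ n * of_nat q ^ n)"
        by (simp add: sum_divide_distrib)
      moreover have tail: "zeta_tail x m s = c * complex_of_real x ^ n" for x
        by (simp only: zeta_tail_def c_def n_def) (simp only: mult_ac)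
      then have "(\<Sum>j=1..q. zeta_tail (a j) m s) = c * (\<Sum>j=1..q. complex_of_real (a j) ^ n)"
        by (simp only: sum_distrib_left)
      moreover have "zeta_tail (1/2) m s = c / 2 ^ n"
        unfolding tail by (simp add: power_divide)
      ultimately have "zeta_tail (1/2) m s - (\<Sum>j=1..q. zeta_tail (a j) m s) / of_nat q
         = (1 - (\<Sum>j=1..q. of_nat (2 * j - 1) ^ n) / of_nat q ^ (n + 1)) * (c / 2 ^ n)"
        by (simp add: algebra_simps)
      also have "\<dots> = (1 - (\<Sum>j=1..q. of_nat (2 * j - 1) ^ n) / of_nat q ^ (n + 1))
          * (Gamma (of_nat n + s) / (2 ^ n * fact n * Gamma s)) * zeta (of_nat n + s)"
        by (simp only: G[symmetric] mult.assoc)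
      finally show ?thesis
        unfolding Let_def n_def .
    qed
    ultimately show ?thesis
      by (simp only:)
  qed
  ultimately show ?thesis
    using hol_F unfolding L_def q_def by blast
qed

end
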